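(* Let $G$ be an almost-bipartite matching covered graph. Then (i) $|V(G)|=2\alpha(G)+1$; (ii) $\mathrm{core}(G)=\emptyset$; (iii) $\ker(G)=\emptyset$; (iv) $\mathrm{corona}(G)=V(G)$.
   Context: All graphs are finite, undirected and simple. $\alpha(G)$ is the maximum cardinality of an independent set of $G$. $\Omega(G)$ is the set of maximum (i.e. maximum-cardinality) independent sets of $G$; $\mathrm{core}(G)=\bigcap_{S\in\Omega(G)}S$ and $\mathrm{corona}(G)=\bigcup_{S\in\Omega(G)}S$. For $X\subseteq V(G)$, $N(X)=\bigcup_{v\in X}N(v)$ and $d_G(X)=|X|-|N(X)|$. An independent set $X$ (possibly empty) is a critical independent set if $d_G(X)$ is maximum over all independent sets of $G$; $\ker(G)$ is the intersection of all critical independent sets of $G$. Adding an ear to a graph $H$: take two vertices $u,v$ of $H$ and add a path from $u$ to $v$ all of whose vertices other than $u,v$ are new; the length of the ear is its number of edges. A graph $G$ is an almost-bipartite matching covered graph if there is a sequence of graphs $G_1,G_2,\dots,G_r,G_{r+1}=G$ such that $G_1=K_2$; $G_i$ is obtained from $G_{i-1}$ by adding an ear of odd length for $i=2,\dots,r$; $G_r$ is bipartite (and hence matching covered); and $G_{r+1}=G$ is obtained from $G_r$ by adding an ear $P$ of even length with $V(P)\cap V(G_r)=V(G_1)$ (so the ends of $P$ are the two vertices of $G_1$). A bipartite matching covered graph is a connected bipartite graph in which every edge belongs to a perfect matching. *)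

theory Defs
  imports "Graph_Theory.Graph_Theory"
begin

text \<open>
  A finite simple undirected graph is a \<^locale>\<open>pair_graph\<close>: a finite, loop-free, symmetric digraph
  whose arcs are pairs, an undirected edge \<open>uv\<close> being the two arcs \<open>(u, v)\<close> and \<open>(v, u)\<close>.
\<close>

definition independent_set :: "'a pair_pre_digraph \<Rightarrow> 'a set \<Rightarrow> bool" where
  "independent_set G S \<longleftrightarrow> S \<subseteq> pverts G \<and> (\<forall>u\<in>S. \<forall>v\<in>S. (u, v) \<notin> parcs G)"

definition independence_number :: "'a pair_pre_digraph \<Rightarrow> nat" where
  "independence_number G = Max (card ` {S. independent_set G S})"

definition max_independent_sets :: "'a pair_pre_digraph \<Rightarrow> 'a set set" where
  "max_independent_sets G = {S. independent_set G S \<and> card S = independence_number G}"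

definition graph_core :: "'a pair_pre_digraph \<Rightarrow> 'a set" where
  "graph_core G = \<Inter> (max_independent_sets G)"

definition graph_corona :: "'a pair_pre_digraph \<Rightarrow> 'a set" where
  "graph_corona G = \<Union> (max_independent_sets G)"

definition neighborhood :: "'a pair_pre_digraph \<Rightarrow> 'a set \<Rightarrow> 'a set" where
  "neighborhood G X = (\<Union>v\<in>X. {w. (v, w) \<in> parcs G})"

definition vertex_difference :: "'a pair_pre_digraph \<Rightarrow> 'a set \<Rightarrow> int" where
  "vertex_difference G X = int (card X) - int (card (neighborhood G X))"

definition critical_independent_set :: "'a pair_pre_digraph \<Rightarrow> 'a set \<Rightarrow> bool" where
  "critical_independent_set G X \<longleftrightarrow> independent_set G X \<and>
     (\<forall>Y. independent_set G Y \<longrightarrow> vertex_difference G Y \<le> vertex_difference G X)"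

definition graph_ker :: "'a pair_pre_digraph \<Rightarrow> 'a set" where
  "graph_ker G = \<Inter> {X. critical_independent_set G X}"

definition bipartite :: "'a pair_pre_digraph \<Rightarrow> bool" where
  "bipartite G \<longleftrightarrow> (\<exists>A B. pverts G = A \<union> B \<and> A \<inter> B = {} \<and> parcs G \<subseteq> A \<times> B \<union> B \<times> A)"

text \<open>
  An ear is given by its vertex sequence; its length is \<^const>\<open>vwalk_length\<close>. The last condition
  only matters for ears of length 1: there the new edge must not already be present, since otherwise
  adding the ear would create a parallel edge.
\<close>

definition is_ear :: "'a pair_pre_digraph \<Rightarrow> 'a \<Rightarrow> 'a \<Rightarrow> 'a vwalk \<Rightarrow> bool" where
  "is_ear H u v p \<longleftrightarrow> u \<in> pverts H \<and> v \<in> pverts H \<and> u \<noteq> v \<and>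
     p \<noteq> [] \<and> hd p = u \<and> last p = v \<and> distinct p \<and>
     set p \<inter> pverts H = {u, v} \<and> set (vwalk_arcs p) \<inter> parcs H = {}"

definition add_ear :: "'a pair_pre_digraph \<Rightarrow> 'a vwalk \<Rightarrow> 'a pair_pre_digraph" where
  "add_ear H p = \<lparr>pverts = pverts H \<union> set p,
     parcs = parcs H \<union> set (vwalk_arcs p) \<union> (set (vwalk_arcs p))\<inverse>\<rparr>"

definition almost_bipartite_matching_covered :: "'a pair_pre_digraph \<Rightarrow> bool" where
  "almost_bipartite_matching_covered G \<longleftrightarrow>
     (\<exists>r (H :: nat \<Rightarrow> 'a pair_pre_digraph). 1 \<le> r \<and>
        K\<^bsub>2\<^esub> (with_proj (H 1)) \<and>
        (\<forall>i\<in>{2..r}. \<exists>u v p. is_ear (H (i - 1)) u v p \<and> odd (vwalk_length p) \<and>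
                              H i = add_ear (H (i - 1)) p) \<and>
        bipartite (H r) \<and>
        (\<exists>u v p. is_ear (H r) u v p \<and> even (vwalk_length p) \<and>
                 set p \<inter> pverts (H r) = pverts (H 1) \<and>
                 H (r + 1) = add_ear (H r) p) \<and>
        H (r + 1) = G)"

lemma vwalk_arcs_mem:
  "(x, y) \<in> set (vwalk_arcs p) \<Longrightarrow> distinct p \<Longrightarrow> x \<in> set p \<and> y \<in> set p \<and> x \<noteq> y"
  by (induction p rule: vwalk_arcs.induct) auto

lemma pair_graph_add_ear:
  assumes "pair_graph H" and "is_ear H u v p"
  shows "pair_graph (add_ear H p)"
proof -
  interpret pair_graph H by fact
  have d: "distinct p" using assms(2) by (simp add: is_ear_def)
  have s: "sym (parcs H)" using sym_arcs by (simp add: symmetric_def)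
  show ?thesis
  proof
    show "symmetric (add_ear H p)"
      using s by (auto simp: symmetric_def add_ear_def sym_def)
  qed (auto simp: add_ear_def dest: in_arcsD1 in_arcsD2 no_loops' vwalk_arcs_mem[OF _ d])
qed

lemma almost_bipartite_matching_covered_pair_graph:
  assumes "almost_bipartite_matching_covered G"
  shows "pair_graph G"
proof -
  obtain r and H :: "nat \<Rightarrow> 'a pair_pre_digraph" where r: "1 \<le> r"
    and K: "K\<^bsub>2\<^esub> (with_proj (H 1))"
    and steps: "\<forall>i\<in>{2..r}. \<exists>u v p. is_ear (H (i - 1)) u v p \<and> odd (vwalk_length p) \<and>
                              H i = add_ear (H (i - 1)) p"
    and last: "\<exists>u v p. is_ear (H r) u v p \<and> H (r + 1) = add_ear (H r) p" and G: "H (r + 1) = G"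
    using assms unfolding almost_bipartite_matching_covered_def by blast
  have "pair_graph (H i)" if "1 \<le> i" "i \<le> r" for i
    using that
  proof (induction i rule: dec_induct)
    case base
    then show ?case using K by (auto simp: complete_digraph_def intro: pair_graphI_graph)
  next
    case (step n)
    then show ?case
      using steps[rule_format, of "Suc n"] by (auto intro: pair_graph_add_ear)
  qed
  then show ?thesis using r last G pair_graph_add_ear by (metis order_refl)
qed

end

theory Submission
  imports Defs
begin

text \<open>
  Write \<open>H\<close> for the bipartite graph before the even ear \<open>p\<close> is added, \<open>A\<close> and \<open>B\<close> for its sides, and
  \<open>u \<in> A\<close>, \<open>v \<in> B\<close> for the two vertices of the initial \<open>K\<^sub>2\<close>, which are the ends of \<open>p\<close>. The edge
  \<open>uv\<close> closes \<open>p\<close> to an odd cycle. The vertices outside this cycle are perfectly matched, because an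
  odd ear has an even number of inner vertices, which can be paired off along the ear. Rotating the
  cycle and swapping the ends of each matching edge gives a permutation of the vertices of \<open>G\<close> that
  moves every vertex to a neighbour.

  Such a permutation maps any vertex set \<open>X\<close> injectively into its neighbourhood, so
  \<open>|X| \<le> |N(X)|\<close>. Hence the empty set is critical and the kernel is empty
  (\<open>graph_ker_empty_if_arc_permutable\<close>). If \<open>X\<close> is independent it is disjoint from \<open>N(X)\<close>, so
  \<open>2|X| \<le> |V(G)|\<close> (\<open>independent_card_le_half\<close>). The same argument inside \<open>H\<close> gives
  \<open>|A| = |B|\<close>, so if \<open>p\<close> has length \<open>2k\<close> then \<open>|V(G)| = 2|A| + 2k - 1\<close> is odd, and
  \<open>\<alpha>(G) \<le> |A| + k - 1\<close>.

  Three independent sets attain this bound: \<open>A\<close> or \<open>B\<close> together with the inner vertices at even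
  positions of \<open>p\<close>, and \<open>A - {u}\<close> together with the vertices at odd positions. Their union is
  \<open>V(G)\<close>, and no vertex lies in all three. This is carried out in \<open>even_ear_max_independent\<close>.
\<close>

section \<open>Permutations along arcs\<close>

text \<open>
  For the arcs of a simple graph this is a perfect 2-matching in disguise: the cycles of the
  permutation are matching edges, traversed back and forth, and cycles of the graph. In this form
  matched pairs and the odd cycle need no separate treatment in the counting arguments.
\<close>

definition arc_permutable :: "'a rel \<Rightarrow> 'a set \<Rightarrow> bool" where
  "arc_permutable R W \<longleftrightarrow> (\<exists>f. bij_betw f W W \<and> (\<forall>w\<in>W. (w, f w) \<in> R))"

lemma arc_permutable_mono:
  "arc_permutable R W \<Longrightarrow> R \<subseteq> R' \<Longrightarrow> arc_permutable R' W"
  unfolding arc_permutable_def by blast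

lemma arc_permutable_empty [simp]: "arc_permutable R {}"
  by (auto simp: arc_permutable_def bij_betw_def)

lemma arc_permutable_Un:
  assumes "arc_permutable R V" "arc_permutable R W" "V \<inter> W = {}"
  shows "arc_permutable R (V \<union> W)"
proof -
  obtain f g where f: "bij_betw f V V" "\<forall>w\<in>V. (w, f w) \<in> R"
    and g: "bij_betw g W W" "\<forall>w\<in>W. (w, g w) \<in> R"
    using assms(1,2) unfolding arc_permutable_def by blast
  let ?h = "\<lambda>x. if x \<in> V then f x else g x"
  have "bij_betw ?h (V \<union> W) (V \<union> W)"
    using bij_betw_disjoint_Un[OF f(1) g(1) assms(3) assms(3)] .
  moreover have "\<forall>w\<in>V \<union> W. (w, ?h w) \<in> R"
    using f(2) g(2) by auto
  ultimately show ?thesis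
    unfolding arc_permutable_def by blast
qed

lemma set_vwalk_arcs_nth:
  "set (vwalk_arcs p) = {(p ! i, p ! Suc i) | i. Suc i < length p}"
proof (induction p rule: vwalk_arcs.induct)
  case (3 x y xs)
  have "{(((x # y # xs) ! i), (x # y # xs) ! Suc i) | i. Suc i < length (x # y # xs)} =
    insert (x, y) {((y # xs) ! i, (y # xs) ! Suc i) | i. Suc i < length (y # xs)}"
    (is "?L = ?R")
  proof
    show "?L \<subseteq> ?R"
    proof
      fix e assume "e \<in> ?L"
      then obtain i where "e = ((x # y # xs) ! i, (x # y # xs) ! Suc i)"
        "Suc i < length (x # y # xs)" by blast
      then show "e \<in> ?R" by (cases i) auto
    qed
    have "((y # xs) ! i, (y # xs) ! Suc i) \<in> ?L" if "Suc i < length (y # xs)" for i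
      using that by (auto intro!: exI[of _ "Suc i"])
    moreover have "(x, y) \<in> ?L" by (auto intro!: exI[of _ 0])
    ultimately show "?R \<subseteq> ?L" by blast
  qed
  with 3 show ?case by simp
qed auto

text \<open>
  Moving each vertex one step forward along the closed walk is the permutation. A list of two
  vertices is allowed: it gives the swap along an edge.
\<close>

lemma arc_permutable_cycle:
  assumes "distinct p" and "set (vwalk_arcs p) \<subseteq> R" and "p \<noteq> [] \<Longrightarrow> (last p, hd p) \<in> R"
  shows "arc_permutable R (set p)"
proof (cases "p = []")
  case False
  let ?n = "length p"
  define ix where "ix = the_inv_into {..<?n} ((!) p)"
  define f where "f x = p ! (Suc (ix x) mod ?n)" for x
  have inj: "inj_on ((!) p) {..<?n}"
    using assms(1) by (auto simp: inj_on_def nth_eq_iff_index_eq)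
  have ix: "ix (p ! i) = i" if "i < ?n" for i
    using that the_inv_into_f_f[OF inj] by (simp add: ix_def)
  have f: "f (p ! i) = p ! (if Suc i = ?n then 0 else Suc i)" if "i < ?n" for i
    using that by (auto simp: f_def ix)
  have "inj_on f (set p)"
  proof (rule inj_onI)
    fix x y assume "x \<in> set p" "y \<in> set p" and eq: "f x = f y"
    then obtain i j where "i < ?n" "x = p ! i" "j < ?n" "y = p ! j"
      by (metis in_set_conv_nth)
    with eq assms(1) False show "x = y"
      by (auto simp: f nth_eq_iff_index_eq split: if_splits)
  qed
  moreover have "f ` set p \<subseteq> set p"
    using False by (auto simp: f_def)
  ultimately have "bij_betw f (set p) (set p)"
    by (simp add: bij_betw_def endo_inj_surj)
  moreover have "(x, f x) \<in> R" if "x \<in> set p" for x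
  proof -
    from that obtain i where i: "i < ?n" "x = p ! i"
      by (metis in_set_conv_nth)
    show ?thesis
    proof (cases "Suc i = ?n")
      case True
      then have "x = last p" "f x = hd p"
        using i False by (auto simp: f last_conv_nth hd_conv_nth simp flip: True)
      then show ?thesis using assms(3) False by simp
    next
      case False
      with i have "Suc i < ?n" by simp
      then have "(p ! i, p ! Suc i) \<in> set (vwalk_arcs p)"
        by (auto simp: set_vwalk_arcs_nth)
      then show ?thesis
        using i False assms(2) by (auto simp: f)
    qed
  qed
  ultimately show ?thesis
    unfolding arc_permutable_def by blast
qed simp

text \<open>
  The first, third, fifth, \<open>\<dots>\<close> edges of a path with an even number of vertices form a perfect matching
  of it.
\<close>

lemma arc_permutable_even_path:
  assumes "even (length q)" "distinct q" "set (vwalk_arcs q) \<subseteq> R" "(set (vwalk_arcs q))\<inverse> \<subseteq> R"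
  shows "arc_permutable R (set q)"
  using assms
proof (induction q rule: induct_list012)
  case (3 x y zs)
  have sub: "set (vwalk_arcs zs) \<subseteq> set (vwalk_arcs (x # y # zs))"
    by (cases zs) auto
  have "arc_permutable R (set zs)"
    using 3 sub by (intro "3.IH"(1)) auto
  moreover have "arc_permutable R (set [x, y])"
    using 3 by (intro arc_permutable_cycle) auto
  moreover have "set [x, y] \<inter> set zs = {}"
    using 3 by auto
  ultimately have "arc_permutable R (set [x, y] \<union> set zs)"
    by (intro arc_permutable_Un)
  then show ?case by (simp add: insert_commute)
qed auto

section \<open>Counting along a permutation\<close>

text \<open>
  This is the easy direction of Hall's theorem, the permutation serving as the system of distinct
  representatives.
\<close>

lemma card_le_neighborhood:
  assumes "arc_permutable (parcs G) W" "X \<subseteq> W" "finite W"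
  shows "card X \<le> card (neighborhood G X \<inter> W)"
proof -
  obtain f where f: "bij_betw f W W" "\<forall>w\<in>W. (w, f w) \<in> parcs G"
    using assms(1) unfolding arc_permutable_def by blast
  have "f ` X \<subseteq> neighborhood G X \<inter> W"
    using f assms(2) by (auto simp: neighborhood_def bij_betw_def)
  moreover have "inj_on f X"
    using f(1) assms(2) by (auto simp: bij_betw_def intro: inj_on_subset)
  ultimately show ?thesis
    using assms(3) by (metis card_image card_mono finite_Int)
qed

lemma arc_permutable_bipartition_card:
  fixes G :: "'a pair_pre_digraph"
  assumes "arc_permutable (parcs G) (A \<union> B)" "finite (A \<union> B)" "A \<inter> B = {}"
    and "parcs G \<subseteq> A \<times> B \<union> B \<times> A"
  shows "card A = card B"
proof (rule antisym)
  have "neighborhood G A \<inter> (A \<union> B) \<subseteq> B" "neighborhood G B \<inter> (A \<union> B) \<subseteq> A"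
    using assms(3,4) by (auto simp: neighborhood_def)
  then show "card A \<le> card B" "card B \<le> card A"
    using card_le_neighborhood[OF assms(1) _ assms(2), of A]
      card_le_neighborhood[OF assms(1) _ assms(2), of B] assms(2)
    by (metis Un_upper1 card_mono finite_Un order_trans, metis Un_upper2 card_mono finite_Un order_trans)
qed

text \<open>
  An independent set and its neighbourhood are disjoint, and the neighbourhood is at least as large.
\<close>

lemma independent_card_le_half:
  assumes "arc_permutable (parcs G) (pverts G)" "finite (pverts G)" "independent_set G S"
  shows "2 * card S \<le> card (pverts G)"
proof -
  let ?N = "neighborhood G S \<inter> pverts G"
  have S: "S \<subseteq> pverts G" and "S \<inter> ?N = {}"
    using assms(3) by (auto simp: independent_set_def neighborhood_def)
  then have "card S + card ?N = card (S \<union> ?N)"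
    using assms(2) by (metis card_Un_disjoint finite_Int finite_subset)
  also have "\<dots> \<le> card (pverts G)"
    using S assms(2) by (intro card_mono) auto
  finally show ?thesis
    using card_le_neighborhood[OF assms(1) S assms(2)] by simp
qed

text \<open>
  No vertex set exceeds its neighbourhood in size, so the empty set, with difference \<open>0\<close>, is critical.
\<close>

lemma graph_ker_empty_if_arc_permutable:
  assumes "pair_graph G" "arc_permutable (parcs G) (pverts G)"
  shows "graph_ker G = {}"
proof -
  interpret pair_graph G by fact
  have "vertex_difference G Y \<le> vertex_difference G {}" if "independent_set G Y" for Y
  proof -
    have Y: "Y \<subseteq> pverts G" using that by (simp add: independent_set_def)
    have "neighborhood G Y \<inter> pverts G = neighborhood G Y"
      using in_arcsD2 by (auto simp: neighborhood_def)
    then show ?thesis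
      using card_le_neighborhood[OF assms(2) Y finite_verts]
      by (simp add: vertex_difference_def neighborhood_def)
  qed
  then have "critical_independent_set G {}"
    by (simp add: critical_independent_set_def independent_set_def)
  then show ?thesis
    by (auto simp: graph_ker_def)
qed

section \<open>Ears\<close>

text \<open>
  The induction step along the odd ears. The pair \<open>{a, b}\<close> is left out because in the end it is covered
  by the odd cycle through the even ear; the new inner vertices form a path with an even number of
  vertices.
\<close>

lemma arc_permutable_add_odd_ear:
  assumes perm: "arc_permutable (parcs H) (pverts H - {a, b})"
    and ab: "a \<in> pverts H" "b \<in> pverts H"
    and ear: "is_ear H u v p" "odd (vwalk_length p)"
  shows "arc_permutable (parcs (add_ear H p)) (pverts (add_ear H p) - {a, b})"
proof -
  have uv: "u \<in> pverts H" "v \<in> pverts H" "u \<noteq> v" "p \<noteq> []" "hd p = u" "last p = v" "distinct p"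
    "set p \<inter> pverts H = {u, v}"
    using ear(1) by (auto simp: is_ear_def)
  obtain q where p: "p = u # q @ [v]"
    using uv(3-6) by (metis append_butlast_last_id last_ConsL last_ConsR list.collapse)
  have q: "even (length q)" "distinct q" "set q \<inter> pverts H = {}"
    using ear(2) uv p by (auto simp: vwalk_length_def)
  have "set (vwalk_arcs q) \<subseteq> set (vwalk_arcs p)"
  proof
    fix e assume "e \<in> set (vwalk_arcs q)"
    then obtain i where "e = (q ! i, q ! Suc i)" "Suc i < length q"
      by (auto simp: set_vwalk_arcs_nth)
    then have "e = (p ! Suc i, p ! Suc (Suc i))" "Suc (Suc i) < length p"
      by (simp_all add: p nth_append)
    then show "e \<in> set (vwalk_arcs p)"
      unfolding set_vwalk_arcs_nth by blast
  qed
  then have "arc_permutable (parcs (add_ear H p)) (set q)"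
    using q by (intro arc_permutable_even_path) (auto simp: add_ear_def)
  moreover have "arc_permutable (parcs (add_ear H p)) (pverts H - {a, b})"
    using perm by (rule arc_permutable_mono) (auto simp: add_ear_def)
  ultimately have "arc_permutable (parcs (add_ear H p)) ((pverts H - {a, b}) \<union> set q)"
    using q(3) by (intro arc_permutable_Un) auto
  moreover have "pverts (add_ear H p) - {a, b} = (pverts H - {a, b}) \<union> set q"
    using uv q ab by (auto simp: add_ear_def p)
  ultimately show ?thesis by simp
qed

text \<open>
  The ear \<open>p\<close> has length \<open>2k\<close>. Both \<open>H\<close> and \<open>G\<close> have permutations along arcs that extend the one on
  \<open>pverts H - {u, v}\<close>: in \<open>H\<close> it is completed by the edge \<open>uv\<close>, in \<open>G\<close> by the odd cycle that \<open>uv\<close>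
  closes with \<open>p\<close>. The first balances the two sides of \<open>H\<close>, the second bounds the independent sets.
  For \<open>k = 1\<close> the only new vertex is at an odd position and is adjacent to both \<open>u\<close> and \<open>v\<close>; a
  maximum independent set that contains it must give up \<open>u\<close>, which explains the set
  \<open>A - {u} \<union> od\<close>.
\<close>

lemma even_ear_max_independent:
  assumes G: "G = add_ear H p" "pair_graph G"
    and ear: "is_ear H u v p" "even (vwalk_length p)"
    and edge: "(u, v) \<in> parcs H" "(v, u) \<in> parcs H"
    and perm: "arc_permutable (parcs H) (pverts H - {u, v})"
    and bip: "pverts H = A \<union> B" "A \<inter> B = {}" "parcs H \<subseteq> A \<times> B \<union> B \<times> A" "u \<in> A"
  shows "card (pverts G) = 2 * independence_number G + 1 \<and>
         graph_core G = {} \<and> graph_ker G = {} \<and> graph_corona G = pverts G"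
proof -
  have uv: "u \<in> pverts H" "v \<in> pverts H" "u \<noteq> v" "p \<noteq> []" "hd p = u" "last p = v" "distinct p"
    "set p \<inter> pverts H = {u, v}"
    using ear(1) by (auto simp: is_ear_def)
  have vG: "pverts G = pverts H \<union> set p"
    and aG: "parcs G = parcs H \<union> set (vwalk_arcs p) \<union> (set (vwalk_arcs p))\<inverse>"
    by (simp_all add: G add_ear_def)
  have fin: "finite (pverts G)"
  proof -
    interpret pair_graph G by (rule G)
    show ?thesis by (rule finite_verts)
  qed
  have finAB: "finite A" "finite B"
    using fin by (auto simp: vG bip)
  have vB: "v \<in> B" "v \<notin> A" "u \<notin> B"
    using edge bip by auto
  have "arc_permutable (parcs H) (set [u, v] \<union> (pverts H - {u, v}))"
    using edge uv perm by (intro arc_permutable_Un arc_permutable_cycle) auto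
  moreover have "set [u, v] \<union> (pverts H - {u, v}) = A \<union> B"
    using uv bip(1) by auto
  ultimately have cardAB: "card A = card B"
    using bip finAB by (intro arc_permutable_bipartition_card[of H]) auto
  have "arc_permutable (parcs G) (set p \<union> (pverts H - {u, v}))"
  proof (rule arc_permutable_Un)
    show "arc_permutable (parcs G) (set p)"
      using uv edge by (intro arc_permutable_cycle) (auto simp: aG)
    show "arc_permutable (parcs G) (pverts H - {u, v})"
      using perm by (rule arc_permutable_mono) (auto simp: aG)
  qed (use uv in auto)
  moreover have "set p \<union> (pverts H - {u, v}) = pverts G"
    using uv by (auto simp: vG)
  ultimately have permG: "arc_permutable (parcs G) (pverts G)"
    by simp

  obtain k where k: "length p = 2 * k + 1" "0 < k"
  proof -
    have "length p \<noteq> 0" "length p \<noteq> 1"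
      using uv by (auto simp: length_Suc_conv)
    moreover obtain k where "length p - 1 = 2 * k"
      using ear(2) by (metis dvdE vwalk_length_simp)
    ultimately have "length p = 2 * k + 1" "0 < k"
      by linarith+
    then show ?thesis by (rule that)
  qed
  have nth_eq: "p ! i = p ! j \<longleftrightarrow> i = j" if "i < 2 * k + 1" "j < 2 * k + 1" for i j
    using that uv(7) k by (simp add: nth_eq_iff_index_eq)
  have p_ends: "p ! 0 = u" "p ! (2 * k) = v"
    using uv k by (auto simp: hd_conv_nth last_conv_nth)
  have inner: "p ! i \<notin> pverts H" if "0 < i" "i < 2 * k" for i
  proof
    assume "p ! i \<in> pverts H"
    moreover have "p ! i \<in> set p" using that k(1) by (intro nth_mem) simp
    ultimately have "p ! i \<in> {u, v}" using uv(8) by blast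
    then have "p ! i = p ! 0 \<or> p ! i = p ! (2 * k)" by (simp add: p_ends)
    then show False using that nth_eq[of i 0] nth_eq[of i "2 * k"] by simp
  qed
  \<comment> \<open>\<open>ev\<close> omits the two ends, which belong to \<open>H\<close>; \<open>od\<close> consists of new vertices only.\<close>
  define ev where "ev = (\<lambda>j. p ! (2 * j)) ` {0<..<k}"
  define od where "od = (\<lambda>j. p ! (2 * j + 1)) ` {..<k}"
  have ev_new: "ev \<inter> pverts H = {}" and od_new: "od \<inter> pverts H = {}"
    using inner by (auto simp: ev_def od_def)
  have ev_od: "ev \<inter> od = {}"
  proof -
    have "p ! (2 * i) \<noteq> p ! (2 * j + 1)" if "i < k" "j < k" for i j
    proof -
      have "2 * i \<noteq> 2 * j + 1" by presburger
      then show ?thesis using that nth_eq[of "2 * i" "2 * j + 1"] by simp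
    qed
    then show ?thesis by (auto simp: ev_def od_def)
  qed
  have card_ev: "card ev = k - 1"
    unfolding ev_def by (subst card_image) (auto simp: inj_on_def nth_eq)
  have card_od: "card od = k"
    unfolding od_def by (subst card_image) (auto simp: inj_on_def nth_eq)
  have nth_cases: "p ! i \<in> {u, v} \<union> ev" if "even i" "i < length p" for i
  proof -
    from that obtain j where "i = 2 * j" "j \<le> k" using k by (auto elim: evenE)
    then show ?thesis
      using p_ends by (cases "j = 0 \<or> j = k") (auto simp: ev_def)
  qed
  have nth_odd: "p ! i \<in> od" if "odd i" "i < length p" for i
    using that k by (auto simp: od_def elim!: oddE)
  have arc_cases: "(x \<in> od \<and> y \<in> {u, v} \<union> ev) \<or> (y \<in> od \<and> x \<in> {u, v} \<union> ev)"
    if "(x, y) \<in> set (vwalk_arcs p)" for x y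
  proof -
    from that obtain i where "x = p ! i" "y = p ! Suc i" "Suc i < length p"
      by (auto simp: set_vwalk_arcs_nth)
    then show ?thesis
      using nth_cases[of i] nth_cases[of "Suc i"] nth_odd[of i] nth_odd[of "Suc i"]
      by (cases "even i") auto
  qed
  have set_p: "set p = {u, v} \<union> ev \<union> od"
  proof
    show "set p \<subseteq> {u, v} \<union> ev \<union> od"
      using nth_cases nth_odd by (metis UnCI in_set_conv_nth subsetI)
    have "ev \<subseteq> set p" "od \<subseteq> set p"
      using k by (auto simp: ev_def od_def)
    moreover have "u \<in> set p" "v \<in> set p"
      using uv by auto
    ultimately show "{u, v} \<union> ev \<union> od \<subseteq> set p"
      by auto
  qed
  have fin_eo: "finite ev" "finite od"
    by (simp_all add: ev_def od_def)

  have vG': "pverts G = A \<union> B \<union> ev \<union> od"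
    using vG set_p uv bip(1) by auto
  have "card (pverts G) = card (A \<union> B) + card (ev \<union> od)"
    unfolding vG' Un_assoc[of "A \<union> B"] using finAB fin_eo bip(1) ev_new od_new
    by (intro card_Un_disjoint) auto
  then have "card (pverts G) = card A + card B + card ev + card od"
    using finAB fin_eo bip(2) ev_od by (simp add: card_Un_disjoint)
  then have card_G: "card (pverts G) = 2 * (card A + k - 1) + 1"
    using k cardAB card_ev card_od by simp

  have indep: "independent_set G S"
    if S: "S \<subseteq> pverts G" "S \<inter> A = {} \<or> S \<inter> B = {}" "S \<inter> od = {} \<or> S \<inter> ({u, v} \<union> ev) = {}" for S
  proof -
    have "(x, y) \<notin> parcs G" if xy: "x \<in> S" "y \<in> S" for x y
    proof
      assume "(x, y) \<in> parcs G"
      then consider "(x, y) \<in> parcs H" | "(x, y) \<in> set (vwalk_arcs p)" | "(y, x) \<in> set (vwalk_arcs p)"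
        unfolding aG by blast
      then show False
      proof cases
        case 1
        then have "(x, y) \<in> A \<times> B \<union> B \<times> A" using bip(3) by blast
        then show False using S(2) xy by blast
      next
        case 2
        then show False using arc_cases S(3) xy by blast
      next
        case 3
        then show False using arc_cases S(3) xy by blast
      qed
    qed
    then show ?thesis
      using S(1) by (simp add: independent_set_def)
  qed
  have disj: "A \<inter> ev = {}" "B \<inter> ev = {}" "A \<inter> od = {}" "B \<inter> od = {}"
    using ev_new od_new bip(1) by blast+
  have indA: "independent_set G (A \<union> ev)"
    using disj ev_od bip(2) by (intro indep) (auto simp: vG')
  have indB: "independent_set G (B \<union> ev)"
    using disj ev_od bip(2) by (intro indep) (auto simp: vG')
  have indO: "independent_set G (A - {u} \<union> od)"
    using disj ev_od bip(2) vB uv(1,2) od_new by (intro indep) (auto simp: vG')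
  have cards: "card (A \<union> ev) = card A + k - 1" "card (B \<union> ev) = card A + k - 1"
    "card (A - {u} \<union> od) = card A + k - 1"
  proof -
    have "(A - {u}) \<inter> od = {}"
      using disj(3) by blast
    moreover have "0 < card A"
      using bip(4) finAB by (auto simp: card_gt_0_iff)
    ultimately show "card (A \<union> ev) = card A + k - 1" "card (B \<union> ev) = card A + k - 1"
      "card (A - {u} \<union> od) = card A + k - 1"
      using disj finAB fin_eo bip(4) cardAB card_ev card_od k by (simp_all add: card_Un_disjoint)
  qed
  have "independence_number G = card A + k - 1"
    unfolding independence_number_def
  proof (rule Max_eqI)
    have "{S. independent_set G S} \<subseteq> Pow (pverts G)"
      by (auto simp: independent_set_def)
    then show "finite (card ` {S. independent_set G S})"
      using fin by (meson finite_Pow_iff finite_imageI finite_subset)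
    show "card A + k - 1 \<in> card ` {S. independent_set G S}"
      using indA cards(1) by (metis image_eqI mem_Collect_eq)
  next
    fix n assume "n \<in> card ` {S. independent_set G S}"
    then show "n \<le> card A + k - 1"
      using independent_card_le_half[OF permG fin] card_G by fastforce
  qed
  then have "card (pverts G) = 2 * independence_number G + 1"
    and "{A \<union> ev, B \<union> ev, A - {u} \<union> od} \<subseteq> max_independent_sets G"
    using card_G indA indB indO cards by (auto simp: max_independent_sets_def)
  moreover from this(2) have "graph_core G \<subseteq> (A \<union> ev) \<inter> (B \<union> ev) \<inter> (A - {u} \<union> od)"
    unfolding graph_core_def by auto
  then have "graph_core G = {}"
    using bip(2) disj(1) ev_od by blast
  moreover have "pverts G \<subseteq> graph_corona G"
    using calculation(2) unfolding vG' graph_corona_def by auto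
  moreover have "graph_corona G \<subseteq> pverts G"
    by (auto simp: graph_corona_def max_independent_sets_def independent_set_def)
  ultimately show ?thesis
    using graph_ker_empty_if_arc_permutable[OF G(2) permG] by blast
qed

theorem lemma4p5:
  fixes G :: "'a pair_pre_digraph"
  assumes "almost_bipartite_matching_covered G"
  shows "card (pverts G) = 2 * independence_number G + 1 \<and>
         graph_core G = {} \<and>
         graph_ker G = {} \<and>
         graph_corona G = pverts G"
proof -
  obtain r and H :: "nat \<Rightarrow> 'a pair_pre_digraph" and u v p where r: "1 \<le> r"
    and K: "K\<^bsub>2\<^esub> (with_proj (H 1))"
    and steps: "\<And>i. i \<in> {2..r} \<Longrightarrow> \<exists>u v p. is_ear (H (i - 1)) u v p \<and> odd (vwalk_length p) \<and>
                              H i = add_ear (H (i - 1)) p"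
    and bip: "bipartite (H r)"
    and ear: "is_ear (H r) u v p" "even (vwalk_length p)"
      "set p \<inter> pverts (H r) = pverts (H 1)" and G: "G = add_ear (H r) p"
    using assms unfolding almost_bipartite_matching_covered_def by metis
  have V1: "pverts (H 1) = {u, v}" and uv: "u \<noteq> v"
    using ear by (auto simp: is_ear_def)
  have A1: "(u, v) \<in> parcs (H 1)" "(v, u) \<in> parcs (H 1)"
    using K V1 uv by (auto simp: complete_digraph_def arcs_ends_conv)
  have "{u, v} \<subseteq> pverts (H i) \<and> (u, v) \<in> parcs (H i) \<and> (v, u) \<in> parcs (H i) \<and>
      arc_permutable (parcs (H i)) (pverts (H i) - {u, v})"
    if "1 \<le> i" "i \<le> r" for i
    using that
  proof (induction i rule: dec_induct)
    case base
    then show ?case using V1 A1 by simp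
  next
    case (step n)
    then obtain x y q where "is_ear (H n) x y q" "odd (vwalk_length q)" "H (Suc n) = add_ear (H n) q"
      using steps[of "Suc n"] by auto
    with step show ?case
      using arc_permutable_add_odd_ear[of "H n" u v x y q] by (auto simp: add_ear_def)
  qed
  then have *: "{u, v} \<subseteq> pverts (H r)" "(u, v) \<in> parcs (H r)" "(v, u) \<in> parcs (H r)"
    "arc_permutable (parcs (H r)) (pverts (H r) - {u, v})"
    using r by auto
  obtain A B where AB: "pverts (H r) = A \<union> B" "A \<inter> B = {}" "parcs (H r) \<subseteq> A \<times> B \<union> B \<times> A"
    using bip unfolding bipartite_def by blast
  note concl = even_ear_max_independent[OF G almost_bipartite_matching_covered_pair_graph[OF assms]
      ear(1,2) *(2-4)]
  show ?thesis
  proof (cases "u \<in> A")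
    case True
    then show ?thesis using concl[OF AB] by blast
  next
    case False
    then have "u \<in> B" using *(1) AB(1) by auto
    then show ?thesis using AB by (intro concl[of B A]) auto
  qed
qed

end
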